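(* Let $(A,\succ,\prec)$ be an anti-dendriform algebra, $E$ a vector space and $\pi:E\to A$ an epimorphism of vector spaces with $V=\mathrm{Ker}(\pi)$. Then $\approx$ is an equivalence relation on the set $GC(A,V)$ of all crossed systems of $(A,\succ,\prec)$ through $V$. Denote $GH^2(A,V)=GC(A,V)/\approx$. Then the map $\Theta:GH^2(A,V)\to\mathcal{C}_{\pi}(E,A)/\approx$, which assigns to the equivalence class of $C(A,V)$ the equivalence class of $A\sharp V$, is a bijection.
   Context: All vector spaces and algebras are over a field $k$, and all algebras are finite-dimensional. An anti-dendriform algebra $(A,\succ,\prec)$ is a vector space with two bilinear maps $\succ,\prec:A\times A\to A$ such that, writing $x\cdot y=x\succ y+x\prec y$, for all $x,y,z$: $x\succ(y\succ z)=-(x\cdot y)\succ z=-x\prec(y\cdot z)=(x\prec y)\prec z$ and $(x\succ y)\prec z=x\succ(y\prec z)$. Homomorphisms preserve both operations. A crossed system of $A$ through $V$ is a system $C(A,V)=(l_{\succ},r_{\succ},l_{\prec},r_{\prec},\omega_1,\omega_2,\succ_V,\prec_V)$ of linear maps $l_{\succ},r_{\succ},l_{\prec},r_{\prec}:A\to\mathrm{End}(V)$ and bilinear maps $\omega_1,\omega_2:A\times A\to V$, $\succ_V,\prec_V:V\times V\to V$ such that the vector space $A\oplus V$ with $$(x,a)\succeq(y,b)=(x\succ y,\ \omega_1(x,y)+l_{\succ}(x)b+r_{\succ}(y)a+a\succ_V b),$$ $$(x,a)\preceq(y,b)=(x\prec y,\ \omega_2(x,y)+l_{\prec}(x)b+r_{\prec}(y)a+a\prec_V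 b)$$ is an anti-dendriform algebra, denoted $A\sharp V$ (the crossed product). Two crossed systems $C(A,V)$ and $C'(A,V)$ (the latter with primed components) are cohomologous, $C(A,V)\approx C'(A,V)$, if there is a linear map $\zeta:A\to V$ such that for all $x,y\in A$, $a,b\in V$: $l_{\prec}(x)a=l'_{\prec}(x)a+\zeta(x)\prec'_V a$, $l_{\succ}(x)a=l'_{\succ}(x)a+\zeta(x)\succ'_V a$; $r_{\prec}(x)a=r'_{\prec}(x)a+a\prec'_V\zeta(x)$, $r_{\succ}(x)a=r'_{\succ}(x)a+a\succ'_V\zeta(x)$; $\omega_1(x,y)+\zeta(x\succ y)=\omega'_1(x,y)+l'_{\succ}(x)\zeta(y)+r'_{\succ}(y)\zeta(x)+\zeta(x)\succ'_V\zeta(y)$; $\omega_2(x,y)+\zeta(x\prec y)=\omega'_2(x,y)+l'_{\prec}(x)\zeta(y)+r'_{\prec}(y)\zeta(x)+\zeta(x)\prec'_V\zeta(y)$; $a\succ_V b=a\succ'_V b$, $a\prec_V b=a\prec'_V b$. $\mathcal{C}_{\pi}(E,A)$ is the collection of all anti-dendriform algebra structures $(\succeq,\preceq)$ on $E$ such that $\pi:E\to A$ is a homomorphism of anti-dendriform algebras. Two such structures are cohomologous ($\approx$) if there is a homomorphism of anti-dendriform algebras $\varphi:(E,\succeq,\preceq)\to(E,\succeq',\preceq')$ that stabilizes $V$ and co-stabilizes $A$, i.e. $\varphi|_V=\mathrm{id}_V$ and $\pi\varphi=\pi$ (such $\varphi$ is automatically bijective). A crossed product $A\sharp V$ is viewed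 as a structure on $E$ by transport along the linear isomorphism $A\oplus V\to E$, $(x,a)\mapsto a+s(x)$, where $s:A\to E$ is a chosen linear section of $\pi$. *)

theory Defs
  imports "HOL-Analysis.Product_Vector" "HOL-Library.FuncSet"
begin

text \<open>
  Vector spaces over a field are given by an explicit scalar multiplication
  (locale \<^locale>\<open>vector_space\<close>).  The spaces \<open>A\<close> and \<open>E\<close> are whole types, but \<open>V = Ker \<pi>\<close> is a
  subspace of \<open>E\<close> and \<open>A \<oplus> V\<close> is the subset \<open>UNIV \<times> V\<close> of a product type; therefore linearity and
  the algebra axioms are relativised to subspaces.
\<close>

definition linear_on ::
  "('k::field \<Rightarrow> 'b::ab_group_add \<Rightarrow> 'b) \<Rightarrow> ('k \<Rightarrow> 'c::ab_group_add \<Rightarrow> 'c) \<Rightarrow>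
    'b set \<Rightarrow> 'c set \<Rightarrow> ('b \<Rightarrow> 'c) \<Rightarrow> bool" where
  "linear_on s1 s2 S T f \<longleftrightarrow>
     (\<forall>x\<in>S. f x \<in> T) \<and>
     (\<forall>x\<in>S. \<forall>y\<in>S. f (x + y) = f x + f y) \<and>
     (\<forall>c. \<forall>x\<in>S. f (s1 c x) = s2 c (f x))"

definition bilinear_on ::
  "('k::field \<Rightarrow> 'b::ab_group_add \<Rightarrow> 'b) \<Rightarrow> ('k \<Rightarrow> 'c::ab_group_add \<Rightarrow> 'c) \<Rightarrow>
    ('k \<Rightarrow> 'd::ab_group_add \<Rightarrow> 'd) \<Rightarrow>
    'b set \<Rightarrow> 'c set \<Rightarrow> 'd set \<Rightarrow> ('b \<Rightarrow> 'c \<Rightarrow> 'd) \<Rightarrow> bool" where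
  "bilinear_on s1 s2 s3 S T U f \<longleftrightarrow>
     (\<forall>x\<in>S. linear_on s2 s3 T U (f x)) \<and>
     (\<forall>y\<in>T. linear_on s1 s3 S U (\<lambda>x. f x y))"

text \<open>By convention every algebra is finite-dimensional; this is part of the definition.\<close>

definition anti_dendriform_on ::
  "('k::field \<Rightarrow> 'b::ab_group_add \<Rightarrow> 'b) \<Rightarrow> 'b set \<Rightarrow> ('b \<Rightarrow> 'b \<Rightarrow> 'b) \<Rightarrow> ('b \<Rightarrow> 'b \<Rightarrow> 'b) \<Rightarrow> bool"
  where
  "anti_dendriform_on s S sc pr \<longleftrightarrow>
     vector_space s \<and> module.subspace s S \<and>
     (\<exists>B. finite B \<and> module.span s B = S) \<and>
     bilinear_on s s s S S S sc \<and> bilinear_on s s s S S S pr \<and>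
     (\<forall>x\<in>S. \<forall>y\<in>S. \<forall>z\<in>S.
        sc x (sc y z) = - sc (sc x y + pr x y) z \<and>
        - sc (sc x y + pr x y) z = - pr x (sc y z + pr y z) \<and>
        - pr x (sc y z + pr y z) = pr (pr x y) z \<and>
        pr (sc x y) z = sc x (pr y z))"

definition anti_dendriform_hom ::
  "('k::field \<Rightarrow> 'b::ab_group_add \<Rightarrow> 'b) \<Rightarrow> ('k \<Rightarrow> 'c::ab_group_add \<Rightarrow> 'c) \<Rightarrow>
    ('b \<Rightarrow> 'b \<Rightarrow> 'b) \<Rightarrow> ('b \<Rightarrow> 'b \<Rightarrow> 'b) \<Rightarrow> ('c \<Rightarrow> 'c \<Rightarrow> 'c) \<Rightarrow> ('c \<Rightarrow> 'c \<Rightarrow> 'c) \<Rightarrow>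
    ('b \<Rightarrow> 'c) \<Rightarrow> bool" where
  "anti_dendriform_hom s1 s2 sc1 pr1 sc2 pr2 f \<longleftrightarrow>
     Vector_Spaces.linear s1 s2 f \<and>
     (\<forall>x y. f (sc1 x y) = sc2 (f x) (f y)) \<and>
     (\<forall>x y. f (pr1 x y) = pr2 (f x) (f y))"

record ('a, 'v) crossed_data =
  lsc :: "'a \<Rightarrow> 'v \<Rightarrow> 'v"
  rsc :: "'a \<Rightarrow> 'v \<Rightarrow> 'v"
  lpr :: "'a \<Rightarrow> 'v \<Rightarrow> 'v"
  rpr :: "'a \<Rightarrow> 'v \<Rightarrow> 'v"
  om1 :: "'a \<Rightarrow> 'a \<Rightarrow> 'v"
  om2 :: "'a \<Rightarrow> 'a \<Rightarrow> 'v"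
  scV :: "'v \<Rightarrow> 'v \<Rightarrow> 'v"
  prV :: "'v \<Rightarrow> 'v \<Rightarrow> 'v"

definition cp_succ ::
  "('a \<Rightarrow> 'a \<Rightarrow> 'a) \<Rightarrow> ('a, 'v::ab_group_add) crossed_data \<Rightarrow> 'a \<times> 'v \<Rightarrow> 'a \<times> 'v \<Rightarrow> 'a \<times> 'v"
  where
  "cp_succ sc C = (\<lambda>(x, a) (y, b). (sc x y, om1 C x y + lsc C x b + rsc C y a + scV C a b))"

definition cp_prec ::
  "('a \<Rightarrow> 'a \<Rightarrow> 'a) \<Rightarrow> ('a, 'v::ab_group_add) crossed_data \<Rightarrow> 'a \<times> 'v \<Rightarrow> 'a \<times> 'v \<Rightarrow> 'a \<times> 'v"
  where
  "cp_prec pr C = (\<lambda>(x, a) (y, b). (pr x y, om2 C x y + lpr C x b + rpr C y a + prV C a b))"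

text \<open>
  The set \<open>GC(A,V)\<close>.  Bilinearity of \<open>lsc\<close> etc. says that \<open>x \<mapsto> lsc x\<close> is a linear map from \<open>A\<close> to
  \<open>End(V)\<close>.  The maps with arguments in \<open>V\<close> are required to be \<^const>\<open>extensional\<close>, so that two
  crossed systems are equal exactly if they agree on \<open>V\<close>.
\<close>

definition GC ::
  "('k::field \<Rightarrow> 'a::ab_group_add \<Rightarrow> 'a) \<Rightarrow> ('k \<Rightarrow> 'v::ab_group_add \<Rightarrow> 'v) \<Rightarrow>
    ('a \<Rightarrow> 'a \<Rightarrow> 'a) \<Rightarrow> ('a \<Rightarrow> 'a \<Rightarrow> 'a) \<Rightarrow> 'v set \<Rightarrow> ('a, 'v) crossed_data set" where
  "GC sA sV sc pr V = {C.
     (\<forall>f \<in> {lsc C, rsc C, lpr C, rpr C}.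
        bilinear_on sA sV sV UNIV V V f \<and> (\<forall>x. f x \<in> extensional V)) \<and>
     (\<forall>w \<in> {om1 C, om2 C}. bilinear_on sA sA sV UNIV UNIV V w) \<and>
     (\<forall>g \<in> {scV C, prV C}.
        bilinear_on sV sV sV V V V g \<and> case_prod g \<in> extensional (V \<times> V)) \<and>
     anti_dendriform_on (module_prod.scale sA sV) (UNIV \<times> V) (cp_succ sc C) (cp_prec pr C)}"

definition GC_cohom ::
  "('k::field \<Rightarrow> 'a::ab_group_add \<Rightarrow> 'a) \<Rightarrow> ('k \<Rightarrow> 'v::ab_group_add \<Rightarrow> 'v) \<Rightarrow>
    ('a \<Rightarrow> 'a \<Rightarrow> 'a) \<Rightarrow> ('a \<Rightarrow> 'a \<Rightarrow> 'a) \<Rightarrow> 'v set \<Rightarrow>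
    (('a, 'v) crossed_data \<times> ('a, 'v) crossed_data) set" where
  "GC_cohom sA sV sc pr V = {(C, C').
     C \<in> GC sA sV sc pr V \<and> C' \<in> GC sA sV sc pr V \<and>
     (\<exists>\<zeta>. linear_on sA sV UNIV V \<zeta> \<and>
       (\<forall>x. \<forall>a\<in>V.
          lpr C x a = lpr C' x a + prV C' (\<zeta> x) a \<and>
          lsc C x a = lsc C' x a + scV C' (\<zeta> x) a \<and>
          rpr C x a = rpr C' x a + prV C' a (\<zeta> x) \<and>
          rsc C x a = rsc C' x a + scV C' a (\<zeta> x)) \<and>
       (\<forall>x y.
          om1 C x y + \<zeta> (sc x y) =
            om1 C' x y + lsc C' x (\<zeta> y) + rsc C' y (\<zeta> x) + scV C' (\<zeta> x) (\<zeta> y) \<and>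
          om2 C x y + \<zeta> (pr x y) =
            om2 C' x y + lpr C' x (\<zeta> y) + rpr C' y (\<zeta> x) + prV C' (\<zeta> x) (\<zeta> y)) \<and>
       (\<forall>a\<in>V. \<forall>b\<in>V. scV C a b = scV C' a b \<and> prV C a b = prV C' a b))}"

definition C_pi ::
  "('k::field \<Rightarrow> 'e::ab_group_add \<Rightarrow> 'e) \<Rightarrow> ('k \<Rightarrow> 'a::ab_group_add \<Rightarrow> 'a) \<Rightarrow>
    ('a \<Rightarrow> 'a \<Rightarrow> 'a) \<Rightarrow> ('a \<Rightarrow> 'a \<Rightarrow> 'a) \<Rightarrow> ('e \<Rightarrow> 'a) \<Rightarrow>
    (('e \<Rightarrow> 'e \<Rightarrow> 'e) \<times> ('e \<Rightarrow> 'e \<Rightarrow> 'e)) set" where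
  "C_pi sE sA sc pr \<pi> = {(scE, prE).
     anti_dendriform_on sE UNIV scE prE \<and>
     anti_dendriform_hom sE sA scE prE sc pr \<pi>}"

definition C_pi_cohom ::
  "('k::field \<Rightarrow> 'e::ab_group_add \<Rightarrow> 'e) \<Rightarrow> ('k \<Rightarrow> 'a::ab_group_add \<Rightarrow> 'a) \<Rightarrow>
    ('a \<Rightarrow> 'a \<Rightarrow> 'a) \<Rightarrow> ('a \<Rightarrow> 'a \<Rightarrow> 'a) \<Rightarrow> ('e \<Rightarrow> 'a) \<Rightarrow>
    ((('e \<Rightarrow> 'e \<Rightarrow> 'e) \<times> ('e \<Rightarrow> 'e \<Rightarrow> 'e)) \<times> (('e \<Rightarrow> 'e \<Rightarrow> 'e) \<times> ('e \<Rightarrow> 'e \<Rightarrow> 'e))) set" where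
  "C_pi_cohom sE sA sc pr \<pi> = {((sc1, pr1), (sc2, pr2)).
     (sc1, pr1) \<in> C_pi sE sA sc pr \<pi> \<and> (sc2, pr2) \<in> C_pi sE sA sc pr \<pi> \<and>
     (\<exists>\<phi>. anti_dendriform_hom sE sE sc1 pr1 sc2 pr2 \<phi> \<and>
       (\<forall>v. \<pi> v = 0 \<longrightarrow> \<phi> v = v) \<and> \<pi> \<circ> \<phi> = \<pi>)}"

definition transport_op :: "('b \<Rightarrow> 'e) \<Rightarrow> 'b set \<Rightarrow> ('b \<Rightarrow> 'b \<Rightarrow> 'b) \<Rightarrow> 'e \<Rightarrow> 'e \<Rightarrow> 'e" where
  "transport_op g S m = (\<lambda>e f. g (m (inv_into S g e) (inv_into S g f)))"

text \<open>The crossed product \<open>A \<sharp> V\<close>, viewed as a structure on \<open>E\<close> by means of a section \<open>s\<close> of \<open>\<pi>\<close>.\<close>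

definition crossed_product_on ::
  "('a \<Rightarrow> 'a \<Rightarrow> 'a) \<Rightarrow> ('a \<Rightarrow> 'a \<Rightarrow> 'a) \<Rightarrow> 'e::ab_group_add set \<Rightarrow> ('a \<Rightarrow> 'e) \<Rightarrow>
    ('a, 'e) crossed_data \<Rightarrow> ('e \<Rightarrow> 'e \<Rightarrow> 'e) \<times> ('e \<Rightarrow> 'e \<Rightarrow> 'e)" where
  "crossed_product_on sc pr V s C =
     (transport_op (\<lambda>(x, a). a + s x) (UNIV \<times> V) (cp_succ sc C),
      transport_op (\<lambda>(x, a). a + s x) (UNIV \<times> V) (cp_prec pr C))"

end

theory Submission
  imports Defs
begin

text \<open>
  Fix the linear section \<open>s\<close>.  Every \<open>e\<close> in \<open>E\<close> is uniquely \<open>a + s x\<close> with \<open>a\<close> in \<open>V\<close> and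
  \<open>x = \<pi> e\<close>, so a bilinear operation on \<open>E\<close> lying over an operation of \<open>A\<close> is determined by its
  values on the four kinds of pairs of elements of \<open>s A\<close> and \<open>V\<close>.  Up to the forced term
  \<open>s (x \<cdot> y)\<close>, these values are exactly the components of a crossed system.  As the algebra axioms
  are carried along the linear isomorphism between \<open>A \<oplus> V\<close> and \<open>E\<close>, the crossed product is a bijection
  from crossed systems to structures on \<open>E\<close> over \<open>A\<close>, before any quotient is taken
  (\<open>bij_betw_crossed_product_on\<close>).

  The two cohomology relations correspond under this bijection (\<open>GC_cohom_iff\<close>).  A linear map
  \<open>\<phi>\<close> stabilizes \<open>V\<close> and co-stabilizes \<open>A\<close> exactly when \<open>\<phi> e = e + \<zeta> (\<pi> e)\<close> for a linear
  \<open>\<zeta> : A \<rightarrow> V\<close> (\<open>stabilizing_iff_shift\<close>), and such a map is multiplicative exactly when \<open>\<zeta>\<close>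
  satisfies the equations that define cohomologous crossed systems
  (\<open>shift_multiplicative_iff\<close>).

  On structures over \<open>A\<close> the relation is an equivalence because the maps \<open>e \<mapsto> e + \<zeta> (\<pi> e)\<close> form a
  group, with \<open>\<zeta>\<close> adding up under composition.  Pulling the relation back along the bijection shows
  that the relation on crossed systems is an equivalence too, and the induced map on classes, the
  image of a class under the crossed product, is the required bijection \<open>\<Theta>\<close>.
\<close>

section \<open>Relative linearity and bilinearity\<close>

lemma linear_on_zero:
  assumes "linear_on s1 s2 S T f" "0 \<in> S"
  shows "f 0 = 0"
proof -
  have "f (0 + 0) = f 0 + f 0"
    using assms unfolding linear_on_def by blast
  then show ?thesis by simp
qed

context
  fixes s1 :: "'k::field \<Rightarrow> 'b::ab_group_add \<Rightarrow> 'b" and s2 :: "'k \<Rightarrow> 'c::ab_group_add \<Rightarrow> 'c"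
    and s3 :: "'k \<Rightarrow> 'd::ab_group_add \<Rightarrow> 'd" and S T U m
  assumes m: "bilinear_on s1 s2 s3 S T U m"
begin

lemma bilinear_on_closed: "x \<in> S \<Longrightarrow> y \<in> T \<Longrightarrow> m x y \<in> U"
  using m unfolding bilinear_on_def linear_on_def by blast

lemma bilinear_on_add_left: "x \<in> S \<Longrightarrow> x' \<in> S \<Longrightarrow> y \<in> T \<Longrightarrow> m (x + x') y = m x y + m x' y"
  using m unfolding bilinear_on_def linear_on_def by blast

lemma bilinear_on_add_right: "x \<in> S \<Longrightarrow> y \<in> T \<Longrightarrow> y' \<in> T \<Longrightarrow> m x (y + y') = m x y + m x y'"
  using m unfolding bilinear_on_def linear_on_def by blast

lemma bilinear_on_scale_left: "x \<in> S \<Longrightarrow> y \<in> T \<Longrightarrow> m (s1 c x) y = s3 c (m x y)"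
  using m unfolding bilinear_on_def linear_on_def by blast

lemma bilinear_on_scale_right: "x \<in> S \<Longrightarrow> y \<in> T \<Longrightarrow> m x (s2 c y) = s3 c (m x y)"
  using m unfolding bilinear_on_def linear_on_def by blast

lemma bilinear_on_zero_left: "0 \<in> S \<Longrightarrow> y \<in> T \<Longrightarrow> m 0 y = 0"
  using m linear_on_zero[of s1 s3 S U "\<lambda>x. m x y"] unfolding bilinear_on_def by blast

lemma bilinear_on_zero_right: "0 \<in> T \<Longrightarrow> x \<in> S \<Longrightarrow> m x 0 = 0"
  using m linear_on_zero[of s2 s3 T U "m x"] unfolding bilinear_on_def by blast

end

lemma bilinear_onI:
  assumes "\<And>x y. x \<in> S \<Longrightarrow> y \<in> T \<Longrightarrow> m x y \<in> U"
    and "\<And>x x' y. x \<in> S \<Longrightarrow> x' \<in> S \<Longrightarrow> y \<in> T \<Longrightarrow> m (x + x') y = m x y + m x' y"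
    and "\<And>x y y'. x \<in> S \<Longrightarrow> y \<in> T \<Longrightarrow> y' \<in> T \<Longrightarrow> m x (y + y') = m x y + m x y'"
    and "\<And>c x y. x \<in> S \<Longrightarrow> y \<in> T \<Longrightarrow> m (s1 c x) y = s3 c (m x y)"
    and "\<And>c x y. x \<in> S \<Longrightarrow> y \<in> T \<Longrightarrow> m x (s2 c y) = s3 c (m x y)"
  shows "bilinear_on s1 s2 s3 S T U m"
  using assms unfolding bilinear_on_def linear_on_def by blast


section \<open>Images of anti-dendriform algebras\<close>

lemma bilinear_on_image:
  assumes m: "bilinear_on s1 s1 s1 S S S m"
    and S: "module.subspace s1 S"
    and f: "Vector_Spaces.linear s1 s2 f"
    and hom: "\<And>x y. x \<in> S \<Longrightarrow> y \<in> S \<Longrightarrow> f (m x y) = m' (f x) (f y)"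
  shows "bilinear_on s2 s2 s2 (f ` S) (f ` S) (f ` S) m'"
proof -
  interpret f: Vector_Spaces.linear s1 s2 f by fact
  note cl = f.vs1.subspace_add[OF S] f.vs1.subspace_scale[OF S] bilinear_on_closed[OF m]
  show ?thesis
  proof (rule bilinear_onI; elim imageE; hypsubst)
    fix x y assume xy: "x \<in> S" "y \<in> S"
    show "m' (f x) (f y) \<in> f ` S"
      using cl(3)[OF xy] by (simp flip: hom add: xy)
    show "m' (s2 c (f x)) (f y) = s2 c (m' (f x) (f y))" for c
      by (simp flip: hom f.scale add: xy cl bilinear_on_scale_left[OF m])
    show "m' (f x) (s2 c (f y)) = s2 c (m' (f x) (f y))" for c
      by (simp flip: hom f.scale add: xy cl bilinear_on_scale_right[OF m])
    fix z assume z: "z \<in> S"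
    show "m' (f x + f y) (f z) = m' (f x) (f z) + m' (f y) (f z)"
      by (simp flip: hom f.add add: xy z cl bilinear_on_add_left[OF m])
    show "m' (f x) (f y + f z) = m' (f x) (f y) + m' (f x) (f z)"
      by (simp flip: hom f.add add: xy z cl bilinear_on_add_right[OF m])
  qed
qed

text \<open>
  Identities and finite spanning sets pass to the image of a multiplicative linear map.  Applied to
  an isomorphism and to its inverse, this moves the algebra structure between \<open>A \<oplus> V\<close> and \<open>E\<close>.
\<close>

lemma anti_dendriform_on_image:
  assumes S: "anti_dendriform_on s1 S sc pr"
    and f: "Vector_Spaces.linear s1 s2 f"
    and sc: "\<And>x y. x \<in> S \<Longrightarrow> y \<in> S \<Longrightarrow> f (sc x y) = sc' (f x) (f y)"
    and pr: "\<And>x y. x \<in> S \<Longrightarrow> y \<in> S \<Longrightarrow> f (pr x y) = pr' (f x) (f y)"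
  shows "anti_dendriform_on s2 (f ` S) sc' pr'"
proof -
  interpret f: Vector_Spaces.linear s1 s2 f by fact
  have sub: "module.subspace s1 S"
    and bsc: "bilinear_on s1 s1 s1 S S S sc" and bpr: "bilinear_on s1 s1 s1 S S S pr"
    using S by (auto simp: anti_dendriform_on_def)
  obtain B where B: "finite B" "f.vs1.span B = S"
    using S by (auto simp: anti_dendriform_on_def)
  have cl: "sc x y \<in> S" "pr x y \<in> S" "x + y \<in> S" if "x \<in> S" "y \<in> S" for x y
    using that bilinear_on_closed[OF bsc] bilinear_on_closed[OF bpr] f.vs1.subspace_add[OF sub]
    by auto
  have id: "sc x (sc y z) = - sc (sc x y + pr x y) z"
    "- sc (sc x y + pr x y) z = - pr x (sc y z + pr y z)"
    "- pr x (sc y z + pr y z) = pr (pr x y) z"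
    "pr (sc x y) z = sc x (pr y z)"
    if "x \<in> S" "y \<in> S" "z \<in> S" for x y z
    using S that unfolding anti_dendriform_on_def by blast+
  have "finite (f ` B)" "f.vs2.span (f ` B) = f ` S"
    using B f.span_image by auto
  moreover have "sc' x (sc' y z) = - sc' (sc' x y + pr' x y) z \<and>
      - sc' (sc' x y + pr' x y) z = - pr' x (sc' y z + pr' y z) \<and>
      - pr' x (sc' y z + pr' y z) = pr' (pr' x y) z \<and> pr' (sc' x y) z = sc' x (pr' y z)"
    if im: "x \<in> f ` S" "y \<in> f ` S" "z \<in> f ` S" for x y z
  proof -
    obtain x0 y0 z0 where xyz: "x0 \<in> S" "y0 \<in> S" "z0 \<in> S" "x = f x0" "y = f y0" "z = f z0"
      using im by blast
    show ?thesis
      unfolding xyz(4-6)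
      using id[OF xyz(1-3), THEN arg_cong[of _ _ f]]
      by (simp add: sc pr f.add f.neg cl xyz(1-3))
  qed
  moreover have "bilinear_on s2 s2 s2 (f ` S) (f ` S) (f ` S) sc'"
    by (rule bilinear_on_image[OF bsc sub f]) (rule sc)
  moreover have "bilinear_on s2 s2 s2 (f ` S) (f ` S) (f ` S) pr'"
    by (rule bilinear_on_image[OF bpr sub f]) (rule pr)
  ultimately show ?thesis
    unfolding anti_dendriform_on_def
    using f.vs2.vector_space_axioms f.subspace_image[OF sub]
    by (intro conjI ballI exI[of _ "f ` B"]) simp_all
qed


section \<open>Equivalence relations pulled back along a bijection\<close>

text \<open>
  The map induced on classes is the direct image: \<open>T\<close> carries the class of \<open>x\<close> onto the whole class
  of \<open>T x\<close> because it is onto \<open>Y\<close>, and direct image is injective on subsets of \<open>X\<close> because \<open>T\<close> is.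
\<close>

lemma bij_betw_quotient_pullback:
  assumes T: "bij_betw T X Y" and S: "equiv Y S"
    and R: "R \<subseteq> X \<times> X" "\<And>x y. x \<in> X \<Longrightarrow> y \<in> X \<Longrightarrow> (x, y) \<in> R \<longleftrightarrow> (T x, T y) \<in> S"
  shows "equiv X R"
    and "x \<in> X \<Longrightarrow> T ` (R `` {x}) = S `` {T x}"
    and "bij_betw ((`) T) (X // R) (Y // S)"
proof -
  have TX: "T x \<in> Y" if "x \<in> X" for x
    using T that by (auto simp: bij_betw_def)
  have "refl_on X R"
    using R S TX by (auto simp: refl_on_def equiv_def)
  moreover have "sym R"
    using R S by (auto simp: sym_def equiv_def)
  moreover have "trans R"
  proof (rule transI)
    fix x y z assume xyz: "(x, y) \<in> R" "(y, z) \<in> R"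
    then have X: "x \<in> X" "y \<in> X" "z \<in> X" using R(1) by auto
    have "(T x, T y) \<in> S" "(T y, T z) \<in> S" using xyz X by (simp_all add: R(2))
    then have "(T x, T z) \<in> S" using S by (meson equiv_def transD)
    then show "(x, z) \<in> R" using X by (simp add: R(2))
  qed
  ultimately show "equiv X R"
    using R(1) by (auto intro: equivI)
  have cls: "T ` (R `` {x}) = S `` {T x}" if x: "x \<in> X" for x
  proof
    show "T ` (R `` {x}) \<subseteq> S `` {T x}"
      using R x by auto
    show "S `` {T x} \<subseteq> T ` (R `` {x})"
    proof
      fix y assume y: "y \<in> S `` {T x}"
      then have "y \<in> Y" using S by (auto simp: equiv_def)
      then obtain x' where "x' \<in> X" "y = T x'"
        using T by (auto simp: bij_betw_def)
      then show "y \<in> T ` (R `` {x})" using y x R by auto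
    qed
  qed
  then show "x \<in> X \<Longrightarrow> T ` (R `` {x}) = S `` {T x}" .
  have "inj_on ((`) T) (X // R)"
  proof (rule inj_onI)
    fix c d assume cd: "c \<in> X // R" "d \<in> X // R" "T ` c = T ` d"
    have "c \<subseteq> X" "d \<subseteq> X"
      using cd(1,2) R(1) by (auto simp: quotient_def)
    then show "c = d"
      using cd(3) T by (auto simp: bij_betw_def inj_on_image_eq_iff)
  qed
  moreover have "(`) T ` (X // R) = Y // S"
  proof -
    have "(`) T ` (X // R) = (\<lambda>x. S `` {T x}) ` X"
      by (simp add: quotient_def UNION_singleton_eq_range image_image cls cong: image_cong_simp)
    also have "\<dots> = (\<lambda>y. S `` {y}) ` (T ` X)" by (simp add: image_image)
    also have "\<dots> = Y // S"
      using T by (simp add: bij_betw_def quotient_def UNION_singleton_eq_range)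
    finally show ?thesis .
  qed
  ultimately show "bij_betw ((`) T) (X // R) (Y // S)"
    by (simp add: bij_betw_def)
qed


section \<open>Splitting a space along a linear section\<close>

locale split_epimorphism =
  pi: Vector_Spaces.linear sE sA \<pi> + sec: Vector_Spaces.linear sA sE s
  for sE :: "'k::field \<Rightarrow> 'e::ab_group_add \<Rightarrow> 'e" and sA :: "'k \<Rightarrow> 'a::ab_group_add \<Rightarrow> 'a"
    and \<pi> :: "'e \<Rightarrow> 'a" and s :: "'a \<Rightarrow> 'e" +
  assumes pi_sec [simp]: "\<pi> (s x) = x"
begin

sublocale prod: vector_space_prod sA sE ..

abbreviation V :: "'e set" where "V \<equiv> {v. \<pi> v = 0}"

abbreviation glue :: "'a \<times> 'e \<Rightarrow> 'e" where "glue \<equiv> \<lambda>(x, a). a + s x"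

text \<open>
  This is the inverse of \<open>glue\<close> on \<open>A \<oplus> V\<close>.  It is linear on all of \<open>E\<close>, so it can be used as a
  homomorphism in its own right.
\<close>

definition coords :: "'e \<Rightarrow> 'a \<times> 'e" where
  "coords e = (\<pi> e, e - s (\<pi> e))"

lemma coords_in: "coords e \<in> UNIV \<times> V"
  by (simp add: coords_def pi.diff)

lemma glue_coords [simp]: "glue (coords e) = e"
  by (simp add: coords_def)

lemma coords_glue: "p \<in> UNIV \<times> V \<Longrightarrow> coords (glue p) = p"
  by (auto simp: coords_def pi.add)

lemma inj_on_glue: "inj_on glue (UNIV \<times> V)"
  by (rule inj_on_inverseI[of _ coords]) (rule coords_glue)

lemma glue_image: "glue ` (UNIV \<times> V) = UNIV"
  using coords_in glue_coords by (metis UNIV_eq_I image_eqI)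

lemma coords_image: "range coords = UNIV \<times> V"
  using coords_in coords_glue by (metis (no_types, lifting) image_subset_iff rangeI subsetI subset_antisym)

lemma coords_sec [simp]: "coords (s x) = (x, 0)"
  by (simp add: coords_def)

lemma coords_kernel [simp]: "a \<in> V \<Longrightarrow> coords a = (0, a)"
  by (simp add: coords_def)

lemma linear_glue: "Vector_Spaces.linear prod.scale sE glue"
  by unfold_locales
    (auto simp: prod.scale_def sec.add sec.scale algebra_simps pi.vs1.scale_right_distrib)

lemma linear_coords: "Vector_Spaces.linear sE prod.scale coords"
  by unfold_locales
    (auto simp: prod.scale_def coords_def pi.add pi.scale sec.add sec.scale
      pi.vs1.scale_right_diff_distrib)

lemma transport_glue:
  "transport_op glue (UNIV \<times> V) m e f = glue (m (coords e) (coords f))"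
proof -
  have "inv_into (UNIV \<times> V) glue e = coords e" for e
    using inv_into_f_f[OF inj_on_glue coords_in] by simp
  then show ?thesis by (simp add: transport_op_def)
qed

text \<open>
  \<open>shift \<zeta>\<close> is the general form of a linear endomorphism of \<open>E\<close> that stabilizes \<open>V\<close> and
  co-stabilizes \<open>A\<close>: such an endomorphism differs from the identity by a map that vanishes on \<open>V\<close> and
  takes values in \<open>V\<close>, hence factors through \<open>\<pi>\<close>.  This is where the \<open>\<zeta>\<close> of the cohomology
  relation on crossed systems comes from.
\<close>

definition shift :: "('a \<Rightarrow> 'e) \<Rightarrow> 'e \<Rightarrow> 'e" where
  "shift \<zeta> e = e + \<zeta> (\<pi> e)"

lemma linear_onV:
  assumes "linear_on sA sE UNIV V \<zeta>"
  shows "\<pi> (\<zeta> x) = 0" "\<zeta> (x + y) = \<zeta> x + \<zeta> y" "\<zeta> (sA c x) = sE c (\<zeta> x)" "\<zeta> 0 = 0"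
  using assms linear_on_zero[OF assms] unfolding linear_on_def by auto

lemma stabilizing_iff_shift:
  "Vector_Spaces.linear sE sE \<phi> \<and> (\<forall>v. \<pi> v = 0 \<longrightarrow> \<phi> v = v) \<and> \<pi> \<circ> \<phi> = \<pi> \<longleftrightarrow>
    (\<exists>\<zeta>. linear_on sA sE UNIV V \<zeta> \<and> \<phi> = shift \<zeta>)"
    (is "?L \<longleftrightarrow> ?R")
proof
  assume L: ?L
  then interpret phi: Vector_Spaces.linear sE sE \<phi> by blast
  have fixV: "\<phi> v = v" if "\<pi> v = 0" for v using L that by blast
  have pi_phi: "\<pi> (\<phi> e) = \<pi> e" for e using L by (auto simp: fun_eq_iff)
  define \<zeta> where "\<zeta> x = \<phi> (s x) - s x" for x
  have "linear_on sA sE UNIV V \<zeta>"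
    by (simp add: linear_on_def \<zeta>_def pi.diff pi_phi sec.add sec.scale phi.add phi.scale
        pi.vs1.scale_right_diff_distrib)
  moreover have "\<phi> e = shift \<zeta> e" for e
  proof -
    have "\<phi> (e - s (\<pi> e)) = e - s (\<pi> e)" by (rule fixV) (simp add: pi.diff)
    then show ?thesis by (simp add: phi.diff shift_def \<zeta>_def algebra_simps)
  qed
  ultimately show ?R by blast
next
  assume ?R
  then obtain \<zeta> where z: "linear_on sA sE UNIV V \<zeta>" "\<phi> = shift \<zeta>" by blast
  have "Vector_Spaces.linear sE sE \<phi>"
    by unfold_locales
      (auto simp: z(2) shift_def linear_onV[OF z(1)] pi.add pi.scale pi.vs1.scale_right_distrib)
  then show ?L
    by (auto simp: z(2) shift_def linear_onV[OF z(1)] pi.add)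
qed


section \<open>One operation: components and compatibility\<close>

text \<open>
  The two operations of a crossed product have the same shape and are treated one at a time.
\<close>

definition crossed_op ::
  "('a \<Rightarrow> 'a \<Rightarrow> 'a) \<Rightarrow> ('a \<Rightarrow> 'a \<Rightarrow> 'e) \<Rightarrow> ('a \<Rightarrow> 'e \<Rightarrow> 'e) \<Rightarrow> ('a \<Rightarrow> 'e \<Rightarrow> 'e) \<Rightarrow>
    ('e \<Rightarrow> 'e \<Rightarrow> 'e) \<Rightarrow> 'a \<times> 'e \<Rightarrow> 'a \<times> 'e \<Rightarrow> 'a \<times> 'e" where
  "crossed_op \<mu> w l r v = (\<lambda>(x, a) (y, b). (\<mu> x y, w x y + l x b + r y a + v a b))"

lemma cp_eq_crossed_op:
  "cp_succ sc C = crossed_op sc (om1 C) (lsc C) (rsc C) (scV C)"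
  "cp_prec pr C = crossed_op pr (om2 C) (lpr C) (rpr C) (prV C)"
  by (simp_all add: cp_succ_def cp_prec_def crossed_op_def)

definition crossed_components ::
  "('a \<Rightarrow> 'a \<Rightarrow> 'e) \<Rightarrow> ('a \<Rightarrow> 'e \<Rightarrow> 'e) \<Rightarrow> ('a \<Rightarrow> 'e \<Rightarrow> 'e) \<Rightarrow> ('e \<Rightarrow> 'e \<Rightarrow> 'e) \<Rightarrow> bool" where
  "crossed_components w l r v \<longleftrightarrow>
     bilinear_on sA sA sE UNIV UNIV V w \<and>
     bilinear_on sA sE sE UNIV V V l \<and> (\<forall>x. l x \<in> extensional V) \<and>
     bilinear_on sA sE sE UNIV V V r \<and> (\<forall>x. r x \<in> extensional V) \<and>
     bilinear_on sE sE sE V V V v \<and> case_prod v \<in> extensional (V \<times> V)"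

abbreviation crossed_op_on_E where
  "crossed_op_on_E \<mu> w l r v \<equiv> transport_op glue (UNIV \<times> V) (crossed_op \<mu> w l r v)"

lemma crossed_components_in_kernel:
  assumes "crossed_components w l r v"
  shows "\<pi> (w x y) = 0" "\<pi> a = 0 \<Longrightarrow> \<pi> (l x a) = 0" "\<pi> a = 0 \<Longrightarrow> \<pi> (r x a) = 0"
    "\<pi> a = 0 \<Longrightarrow> \<pi> b = 0 \<Longrightarrow> \<pi> (v a b) = 0"
  using assms unfolding crossed_components_def bilinear_on_def linear_on_def by auto

lemma pi_crossed_op_on_E:
  assumes "crossed_components w l r v"
  shows "\<pi> (crossed_op_on_E \<mu> w l r v e f) = \<mu> (\<pi> e) (\<pi> f)"
  by (simp add: transport_glue coords_def crossed_op_def pi.add pi.diff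
      crossed_components_in_kernel[OF assms])

lemma crossed_op_closed:
  assumes "crossed_components w l r v" "p \<in> UNIV \<times> V" "q \<in> UNIV \<times> V"
  shows "crossed_op \<mu> w l r v p q \<in> UNIV \<times> V"
  using assms(2,3)
  by (auto simp: crossed_op_def pi.add crossed_components_in_kernel[OF assms(1)])

subsection \<open>Recovering the components\<close>

text \<open>
  The components of an operation \<open>m\<close> on \<open>E\<close> over \<open>\<mu>\<close>, read off from its values on \<open>s A\<close> and \<open>V\<close>.
  Restricting to \<open>V\<close> follows the convention for crossed systems and makes the components unique.
  The operation on \<open>V\<close> takes two arguments, hence the detour through pairs.
\<close>

definition comp_om where "comp_om \<mu> m x y = m (s x) (s y) - s (\<mu> x y)"
definition comp_l where "comp_l m x = restrict (m (s x)) V"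
definition comp_r where "comp_r m x = restrict (\<lambda>a. m a (s x)) V"
definition comp_v where "comp_v m = curry (restrict (case_prod m) (V \<times> V))"

text \<open>
  All other terms of the crossed operation vanish on a pair of elements of \<open>s A\<close> and \<open>V\<close>, since one
  of their arguments is \<open>0\<close>; bilinearity of \<open>\<mu>\<close> makes the summand \<open>s (\<mu> x y)\<close> vanish when \<open>x\<close> or
  \<open>y\<close> does.
\<close>

lemma components_crossed_op_on_E:
  assumes c: "crossed_components w l r v" and \<mu>: "bilinear_on sA sA sA UNIV UNIV UNIV \<mu>"
  defines "m \<equiv> crossed_op_on_E \<mu> w l r v"
  shows "comp_om \<mu> m = w" "comp_l m = l" "comp_r m = r" "comp_v m = v"
proof -
  have bil: "bilinear_on sA sA sE UNIV UNIV V w" "bilinear_on sA sE sE UNIV V V l"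
    "bilinear_on sA sE sE UNIV V V r" "bilinear_on sE sE sE V V V v"
    and ext: "l x \<in> extensional V" "r x \<in> extensional V" "case_prod v \<in> extensional (V \<times> V)" for x
    using c by (auto simp: crossed_components_def)
  note zeros = bil(1,2,3,4)[THEN bilinear_on_zero_left] bil(1,2,3,4)[THEN bilinear_on_zero_right]
    \<mu>[THEN bilinear_on_zero_left] \<mu>[THEN bilinear_on_zero_right]
  note m = m_def transport_glue crossed_op_def
  show "comp_om \<mu> m = w"
    by (simp add: fun_eq_iff comp_om_def m zeros)
  show "comp_l m = l"
  proof
    fix x show "comp_l m x = l x"
      by (rule extensionalityI[of _ V]) (auto simp: comp_l_def m zeros ext)
  qed
  show "comp_r m = r"
  proof
    fix x show "comp_r m x = r x"
      by (rule extensionalityI[of _ V]) (auto simp: comp_r_def m zeros ext)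
  qed
  have "restrict (case_prod m) (V \<times> V) = case_prod v"
    by (rule extensionalityI[of _ "V \<times> V"]) (auto simp: m zeros ext)
  then show "comp_v m = v"
    by (simp add: comp_v_def)
qed

context
  fixes \<mu> m
  assumes m: "bilinear_on sE sE sE UNIV UNIV UNIV m"
    and \<mu>: "bilinear_on sA sA sA UNIV UNIV UNIV \<mu>"
    and pi_m: "\<And>e f. \<pi> (m e f) = \<mu> (\<pi> e) (\<pi> f)"
begin

text \<open>
  Compatibility of \<open>m\<close> with \<open>\<pi>\<close> is what puts the values into \<open>V\<close>: \<open>m\<close> maps into the kernel when one
  argument lies there, as \<open>\<mu>\<close> vanishes on \<open>0\<close>, and \<open>m (s x) (s y)\<close> lies over \<open>\<mu> x y\<close>.
\<close>

lemma crossed_components_comp: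
  "crossed_components (comp_om \<mu> m) (comp_l m) (comp_r m) (comp_v m)"
proof -
  note m_simps = bilinear_on_add_left[OF m] bilinear_on_add_right[OF m]
    bilinear_on_scale_left[OF m] bilinear_on_scale_right[OF m]
  note mu_simps = bilinear_on_add_left[OF \<mu>] bilinear_on_add_right[OF \<mu>]
    bilinear_on_scale_left[OF \<mu>] bilinear_on_scale_right[OF \<mu>]
    bilinear_on_zero_left[OF \<mu>] bilinear_on_zero_right[OF \<mu>]
  show ?thesis
    unfolding crossed_components_def
    by (intro conjI allI bilinear_onI)
      (auto simp: comp_om_def comp_l_def comp_r_def comp_v_def m_simps mu_simps pi_m
        pi.add pi.diff pi.scale sec.add sec.scale pi.vs1.scale_right_diff_distrib)
qed

text \<open>
  Expanding \<open>m (a + s x) (b + s y)\<close> gives four terms, one for each component; the summand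
  \<open>s (\<mu> x y)\<close> subtracted in \<open>comp_om\<close> is put back by \<open>glue\<close>.
\<close>

lemma crossed_op_on_E_components:
  "crossed_op_on_E \<mu> (comp_om \<mu> m) (comp_l m) (comp_r m) (comp_v m) = m"
proof (intro ext)
  fix e f
  obtain x a y b where ab: "coords e = (x, a)" "coords f = (y, b)" "a \<in> V" "b \<in> V"
    using coords_in[of e] coords_in[of f] by (cases "coords e"; cases "coords f") auto
  have ef: "e = a + s x" "f = b + s y"
    using glue_coords[of e] glue_coords[of f] ab by auto
  have "crossed_op_on_E \<mu> (comp_om \<mu> m) (comp_l m) (comp_r m) (comp_v m) e f =
      m (a + s x) (b + s y)"
    using ab(3,4)
    by (simp add: transport_glue ab(1,2) crossed_op_def comp_om_def comp_l_def comp_r_def comp_v_def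
        bilinear_on_add_left[OF m] bilinear_on_add_right[OF m])
  then show "crossed_op_on_E \<mu> (comp_om \<mu> m) (comp_l m) (comp_r m) (comp_v m) e f = m e f"
    by (simp add: ef)
qed

end

subsection \<open>Compatibility with a shift\<close>

text \<open>
  On \<open>A \<oplus> V\<close> the shift by \<open>\<zeta>\<close> reads \<open>(x, a) \<mapsto> (x, a + \<zeta> x)\<close>.  By bilinearity it is multiplicative
  as soon as it is so on pairs of elements of \<open>A\<close> and \<open>V\<close>; the four kinds of pairs give the four
  families of equations.
\<close>

lemma shift_multiplicative_iff:
  assumes c: "crossed_components w l r v" and c': "crossed_components w' l' r' v'"
    and \<mu>: "bilinear_on sA sA sA UNIV UNIV UNIV \<mu>" and \<zeta>: "linear_on sA sE UNIV V \<zeta>"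
  shows "(\<forall>e f. shift \<zeta> (crossed_op_on_E \<mu> w l r v e f) =
              crossed_op_on_E \<mu> w' l' r' v' (shift \<zeta> e) (shift \<zeta> f)) \<longleftrightarrow>
      (\<forall>x. \<forall>a\<in>V. l x a = l' x a + v' (\<zeta> x) a \<and> r x a = r' x a + v' a (\<zeta> x)) \<and>
      (\<forall>x y. w x y + \<zeta> (\<mu> x y) = w' x y + l' x (\<zeta> y) + r' y (\<zeta> x) + v' (\<zeta> x) (\<zeta> y)) \<and>
      (\<forall>a\<in>V. \<forall>b\<in>V. v a b = v' a b)"
    (is "?H \<longleftrightarrow> ?E")
proof -
  have bil: "bilinear_on sA sA sE UNIV UNIV V w" "bilinear_on sA sE sE UNIV V V l"
    "bilinear_on sA sE sE UNIV V V r" "bilinear_on sE sE sE V V V v"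
    using c by (auto simp: crossed_components_def)
  have bil': "bilinear_on sA sA sE UNIV UNIV V w'" "bilinear_on sA sE sE UNIV V V l'"
    "bilinear_on sA sE sE UNIV V V r'" "bilinear_on sE sE sE V V V v'"
    using c' by (auto simp: crossed_components_def)
  note zeros = bil(1,2,3,4)[THEN bilinear_on_zero_left] bil(1,2,3,4)[THEN bilinear_on_zero_right]
    bil'(1,2,3,4)[THEN bilinear_on_zero_left] bil'(1,2,3,4)[THEN bilinear_on_zero_right]
    \<mu>[THEN bilinear_on_zero_left] \<mu>[THEN bilinear_on_zero_right]
  note adds = bil'(2-4)[THEN bilinear_on_add_left] bil'(2-4)[THEN bilinear_on_add_right]
  note z = linear_onV[OF \<zeta>]
  \<comment> \<open>the shift in the coordinates \<open>A \<oplus> V\<close>\<close>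
  define F where "F = (\<lambda>(x, a). (x, a + \<zeta> x))"
  have F_in: "F p \<in> UNIV \<times> V" if "p \<in> UNIV \<times> V" for p
    using that z by (auto simp: F_def pi.add)
  have shift_glue: "shift \<zeta> (glue p) = glue (F p)" if "p \<in> UNIV \<times> V" for p
    using that by (auto simp: shift_def F_def pi.add)
  have "shift \<zeta> (crossed_op_on_E \<mu> w l r v (glue p) (glue q)) =
        crossed_op_on_E \<mu> w' l' r' v' (shift \<zeta> (glue p)) (shift \<zeta> (glue q)) \<longleftrightarrow>
      F (crossed_op \<mu> w l r v p q) = crossed_op \<mu> w' l' r' v' (F p) (F q)"
    if "p \<in> UNIV \<times> V" "q \<in> UNIV \<times> V" for p q
    unfolding shift_glue[OF that(1)] shift_glue[OF that(2)] transport_glue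
      coords_glue[OF that(1)] coords_glue[OF that(2)]
      coords_glue[OF F_in[OF that(1)]] coords_glue[OF F_in[OF that(2)]]
      shift_glue[OF crossed_op_closed[OF c that]]
    by (rule inj_on_eq_iff[OF inj_on_glue F_in[OF crossed_op_closed[OF c that]]
          crossed_op_closed[OF c' F_in[OF that(1)] F_in[OF that(2)]]])
  then have "?H \<longleftrightarrow> (\<forall>p \<in> UNIV \<times> V. \<forall>q \<in> UNIV \<times> V.
      F (crossed_op \<mu> w l r v p q) = crossed_op \<mu> w' l' r' v' (F p) (F q))"
    by (metis (no_types, lifting) coords_in glue_coords)
  \<comment> \<open>the first coordinates always agree, so only the \<open>V\<close>-parts are compared\<close>
  also have "\<dots> \<longleftrightarrow> (\<forall>x y. \<forall>a\<in>V. \<forall>b\<in>V.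
      w x y + l x b + r y a + v a b + \<zeta> (\<mu> x y) =
      w' x y + l' x (b + \<zeta> y) + r' y (a + \<zeta> x) + v' (a + \<zeta> x) (b + \<zeta> y))"
    by (auto simp: F_def crossed_op_def)
  also have "\<dots> \<longleftrightarrow> ?E"
  proof
    assume H: "\<forall>x y. \<forall>a\<in>V. \<forall>b\<in>V.
      w x y + l x b + r y a + v a b + \<zeta> (\<mu> x y) =
      w' x y + l' x (b + \<zeta> y) + r' y (a + \<zeta> x) + v' (a + \<zeta> x) (b + \<zeta> y)"
    have "l x a = l' x a + v' (\<zeta> x) a" "r x a = r' x a + v' a (\<zeta> x)" if "a \<in> V" for x a
      using H[rule_format, of 0 a x 0] H[rule_format, of a 0 0 x] that by (auto simp: zeros z)
    moreover have "w x y + \<zeta> (\<mu> x y) = w' x y + l' x (\<zeta> y) + r' y (\<zeta> x) + v' (\<zeta> x) (\<zeta> y)" for x y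
      using H[rule_format, of 0 0 x y] by (simp add: zeros)
    moreover have "v a b = v' a b" if "a \<in> V" "b \<in> V" for a b
      using H[rule_format, of a b 0 0] that by (auto simp: zeros z)
    ultimately show ?E by blast
  next
    assume E: ?E
    show "\<forall>x y. \<forall>a\<in>V. \<forall>b\<in>V.
      w x y + l x b + r y a + v a b + \<zeta> (\<mu> x y) =
      w' x y + l' x (b + \<zeta> y) + r' y (a + \<zeta> x) + v' (a + \<zeta> x) (b + \<zeta> y)"
    proof (intro allI ballI)
      fix x y a b assume ab: "a \<in> V" "b \<in> V"
      have "w x y + l x b + r y a + v a b + \<zeta> (\<mu> x y) =
          (w x y + \<zeta> (\<mu> x y)) + l x b + r y a + v a b"
        by (simp add: algebra_simps)
      also have "\<dots> = (w' x y + l' x (\<zeta> y) + r' y (\<zeta> x) + v' (\<zeta> x) (\<zeta> y)) +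
          (l' x b + v' (\<zeta> x) b) + (r' y a + v' a (\<zeta> y)) + v' a b"
        using E ab by metis
      also have "\<dots> = w' x y + l' x (b + \<zeta> y) + r' y (a + \<zeta> x) + v' (a + \<zeta> x) (b + \<zeta> y)"
        using ab by (simp add: adds z pi.add)
      finally show "w x y + l x b + r y a + v a b + \<zeta> (\<mu> x y) =
        w' x y + l' x (b + \<zeta> y) + r' y (a + \<zeta> x) + v' (a + \<zeta> x) (b + \<zeta> y)" .
    qed
  qed
  finally show ?thesis .
qed

end


section \<open>Crossed systems and algebra structures over A\<close>

locale split_algebra_epimorphism = split_epimorphism sE sA \<pi> s
  for sE :: "'k::field \<Rightarrow> 'e::ab_group_add \<Rightarrow> 'e" and sA :: "'k \<Rightarrow> 'a::ab_group_add \<Rightarrow> 'a"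
    and \<pi> s +
  fixes sc pr :: "'a \<Rightarrow> 'a \<Rightarrow> 'a"
  assumes bilinear_sc: "bilinear_on sA sA sA UNIV UNIV UNIV sc"
    and bilinear_pr: "bilinear_on sA sA sA UNIV UNIV UNIV pr"
begin

lemma GC_iff:
  "C \<in> GC sA sE sc pr V \<longleftrightarrow>
     crossed_components (om1 C) (lsc C) (rsc C) (scV C) \<and>
     crossed_components (om2 C) (lpr C) (rpr C) (prV C) \<and>
     anti_dendriform_on prod.scale (UNIV \<times> V) (cp_succ sc C) (cp_prec pr C)"
  unfolding GC_def crossed_components_def by auto

definition components_of where
  "components_of = (\<lambda>(m, n).
    \<lparr>lsc = comp_l m, rsc = comp_r m, lpr = comp_l n, rpr = comp_r n,
     om1 = comp_om sc m, om2 = comp_om pr n, scV = comp_v m, prV = comp_v n\<rparr>)"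

lemma crossed_product_on_eq:
  "crossed_product_on sc pr V s C =
    (crossed_op_on_E sc (om1 C) (lsc C) (rsc C) (scV C),
     crossed_op_on_E pr (om2 C) (lpr C) (rpr C) (prV C))"
  by (simp add: crossed_product_on_def cp_eq_crossed_op)

lemma crossed_product_on_in_C_pi:
  assumes C: "C \<in> GC sA sE sc pr V"
  shows "crossed_product_on sc pr V s C \<in> C_pi sE sA sc pr \<pi>"
proof -
  have c: "crossed_components (om1 C) (lsc C) (rsc C) (scV C)"
      "crossed_components (om2 C) (lpr C) (rpr C) (prV C)"
    and ad: "anti_dendriform_on prod.scale (UNIV \<times> V) (cp_succ sc C) (cp_prec pr C)"
    using C by (auto simp: GC_iff)
  have glue_hom: "glue (m p q) = transport_op glue (UNIV \<times> V) m (glue p) (glue q)"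
    if "p \<in> UNIV \<times> V" "q \<in> UNIV \<times> V" for m p q
    by (simp only: transport_glue coords_glue[OF that(1)] coords_glue[OF that(2)])
  have "anti_dendriform_on sE (glue ` (UNIV \<times> V))
      (transport_op glue (UNIV \<times> V) (cp_succ sc C)) (transport_op glue (UNIV \<times> V) (cp_prec pr C))"
    by (rule anti_dendriform_on_image[OF ad linear_glue]; rule glue_hom)
  then show ?thesis
    by (simp add: C_pi_def crossed_product_on_eq glue_image cp_eq_crossed_op anti_dendriform_hom_def
        pi.linear_axioms pi_crossed_op_on_E[OF c(1)] pi_crossed_op_on_E[OF c(2)])
qed

lemma components_of_crossed_product_on:
  assumes "C \<in> GC sA sE sc pr V"
  shows "components_of (crossed_product_on sc pr V s C) = C"
  using assms
  by (simp add: GC_iff components_of_def crossed_product_on_eq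
      components_crossed_op_on_E bilinear_sc bilinear_pr)

lemma crossed_product_on_components_of:
  assumes "M \<in> C_pi sE sA sc pr \<pi>"
  shows "components_of M \<in> GC sA sE sc pr V"
    and "crossed_product_on sc pr V s (components_of M) = M"
proof -
  obtain m n where M: "M = (m, n)" by fastforce
  have ad: "anti_dendriform_on sE UNIV m n"
    and m: "bilinear_on sE sE sE UNIV UNIV UNIV m" and n: "bilinear_on sE sE sE UNIV UNIV UNIV n"
    and pi: "\<And>e f. \<pi> (m e f) = sc (\<pi> e) (\<pi> f)" "\<And>e f. \<pi> (n e f) = pr (\<pi> e) (\<pi> f)"
    using assms by (auto simp: M C_pi_def anti_dendriform_on_def anti_dendriform_hom_def)
  note cm = crossed_components_comp[OF m bilinear_sc pi(1)]
    and cn = crossed_components_comp[OF n bilinear_pr pi(2)]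
  show eq: "crossed_product_on sc pr V s (components_of M) = M"
    by (simp add: M crossed_product_on_eq components_of_def
        crossed_op_on_E_components[OF m bilinear_sc pi(1)]
        crossed_op_on_E_components[OF n bilinear_pr pi(2)])
  have coords_hom: "coords (k e f) = crossed_op \<mu> w l r v (coords e) (coords f)"
    if "crossed_op_on_E \<mu> w l r v = k" "crossed_components w l r v" for k \<mu> w l r v e f
    unfolding that(1)[symmetric] transport_glue
    by (rule coords_glue[OF crossed_op_closed[OF that(2) coords_in coords_in]])
  have "anti_dendriform_on prod.scale (range coords)
     (cp_succ sc (components_of M)) (cp_prec pr (components_of M))"
    unfolding cp_eq_crossed_op M components_of_def
    by (rule anti_dendriform_on_image[OF ad linear_coords])
      (simp_all add: coords_hom[OF crossed_op_on_E_components[OF m bilinear_sc pi(1)] cm]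
         coords_hom[OF crossed_op_on_E_components[OF n bilinear_pr pi(2)] cn])
  then show "components_of M \<in> GC sA sE sc pr V"
    unfolding GC_iff coords_image using cm cn by (simp add: components_of_def M)
qed

text \<open>
  With \<open>s\<close> fixed, a structure on \<open>E\<close> over \<open>A\<close> is the same thing as a crossed system, before passing
  to any quotient.
\<close>

lemma bij_betw_crossed_product_on:
  "bij_betw (crossed_product_on sc pr V s) (GC sA sE sc pr V) (C_pi sE sA sc pr \<pi>)"
  by (rule bij_betw_byWitness[of _ components_of])
    (auto simp: components_of_crossed_product_on crossed_product_on_components_of
      crossed_product_on_in_C_pi)

lemma C_pi_cohom_iff:
  "((m, n), (m', n')) \<in> C_pi_cohom sE sA sc pr \<pi> \<longleftrightarrow>
     (m, n) \<in> C_pi sE sA sc pr \<pi> \<and> (m', n') \<in> C_pi sE sA sc pr \<pi> \<and>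
     (\<exists>\<zeta>. linear_on sA sE UNIV V \<zeta> \<and>
        (\<forall>e f. shift \<zeta> (m e f) = m' (shift \<zeta> e) (shift \<zeta> f)) \<and>
        (\<forall>e f. shift \<zeta> (n e f) = n' (shift \<zeta> e) (shift \<zeta> f)))"
proof -
  have "(\<exists>\<phi>. anti_dendriform_hom sE sE m n m' n' \<phi> \<and> (\<forall>v. \<pi> v = 0 \<longrightarrow> \<phi> v = v) \<and> \<pi> \<circ> \<phi> = \<pi>) \<longleftrightarrow>
    (\<exists>\<phi>. (Vector_Spaces.linear sE sE \<phi> \<and> (\<forall>v. \<pi> v = 0 \<longrightarrow> \<phi> v = v) \<and> \<pi> \<circ> \<phi> = \<pi>) \<and>
      (\<forall>e f. \<phi> (m e f) = m' (\<phi> e) (\<phi> f)) \<and> (\<forall>e f. \<phi> (n e f) = n' (\<phi> e) (\<phi> f)))"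
    unfolding anti_dendriform_hom_def by blast
  then show ?thesis
    unfolding C_pi_cohom_def stabilizing_iff_shift by auto
qed

text \<open>
  Shifts by \<open>0\<close>, \<open>- \<zeta>\<close> and \<open>\<zeta> + \<eta>\<close> are the identity, the inverse and the composition, because a shift
  does not change \<open>\<pi> e\<close>.
\<close>

lemma equiv_C_pi_cohom: "equiv (C_pi sE sA sc pr \<pi>) (C_pi_cohom sE sA sc pr \<pi>)"
proof (rule equivI)
  show "C_pi_cohom sE sA sc pr \<pi> \<subseteq> C_pi sE sA sc pr \<pi> \<times> C_pi sE sA sc pr \<pi>"
    by (auto simp: C_pi_cohom_def)
  show "refl_on (C_pi sE sA sc pr \<pi>) (C_pi_cohom sE sA sc pr \<pi>)"
  proof (rule refl_onI, clarify)
    fix m n assume "(m, n) \<in> C_pi sE sA sc pr \<pi>"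
    moreover have "linear_on sA sE UNIV V (\<lambda>_. 0)"
      by (simp add: linear_on_def)
    moreover have "shift (\<lambda>_. 0) e = e" for e
      by (simp add: shift_def)
    ultimately show "((m, n), (m, n)) \<in> C_pi_cohom sE sA sc pr \<pi>"
      unfolding C_pi_cohom_iff by (intro conjI exI[of _ "\<lambda>_. 0"]) simp_all
  qed
  show "sym (C_pi_cohom sE sA sc pr \<pi>)"
  proof (rule symI, clarify)
    fix m n m' n' assume "((m, n), (m', n')) \<in> C_pi_cohom sE sA sc pr \<pi>"
    then obtain \<zeta> where st: "(m, n) \<in> C_pi sE sA sc pr \<pi>" "(m', n') \<in> C_pi sE sA sc pr \<pi>"
      and \<zeta>: "linear_on sA sE UNIV V \<zeta>"
      and hom: "\<And>e f. shift \<zeta> (m e f) = m' (shift \<zeta> e) (shift \<zeta> f)"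
        "\<And>e f. shift \<zeta> (n e f) = n' (shift \<zeta> e) (shift \<zeta> f)"
      unfolding C_pi_cohom_iff by blast
    let ?\<eta> = "\<lambda>x. - \<zeta> x"
    have \<eta>: "linear_on sA sE UNIV V ?\<eta>"
      by (simp add: linear_on_def linear_onV[OF \<zeta>] pi.neg)
    have inv: "shift ?\<eta> (shift \<zeta> e) = e" "shift \<zeta> (shift ?\<eta> e) = e" for e
      by (simp_all add: shift_def pi.add pi.diff linear_onV[OF \<zeta>])
    have "shift ?\<eta> (m' e f) = m (shift ?\<eta> e) (shift ?\<eta> f)"
      "shift ?\<eta> (n' e f) = n (shift ?\<eta> e) (shift ?\<eta> f)" for e f
      using hom inv by metis+
    then show "((m', n'), (m, n)) \<in> C_pi_cohom sE sA sc pr \<pi>"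
      unfolding C_pi_cohom_iff using st \<eta> by blast
  qed
  show "trans (C_pi_cohom sE sA sc pr \<pi>)"
  proof (rule transI, clarify)
    fix m n m' n' m'' n''
    assume 1: "((m, n), (m', n')) \<in> C_pi_cohom sE sA sc pr \<pi>"
      and 2: "((m', n'), (m'', n'')) \<in> C_pi_cohom sE sA sc pr \<pi>"
    from 1 obtain \<zeta> where \<zeta>: "linear_on sA sE UNIV V \<zeta>"
      and hom: "\<And>e f. shift \<zeta> (m e f) = m' (shift \<zeta> e) (shift \<zeta> f)"
        "\<And>e f. shift \<zeta> (n e f) = n' (shift \<zeta> e) (shift \<zeta> f)"
      unfolding C_pi_cohom_iff by blast
    from 2 obtain \<eta> where \<eta>: "linear_on sA sE UNIV V \<eta>"
      and hom': "\<And>e f. shift \<eta> (m' e f) = m'' (shift \<eta> e) (shift \<eta> f)"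
        "\<And>e f. shift \<eta> (n' e f) = n'' (shift \<eta> e) (shift \<eta> f)"
      unfolding C_pi_cohom_iff by blast
    let ?\<theta> = "\<lambda>x. \<zeta> x + \<eta> x"
    have "linear_on sA sE UNIV V ?\<theta>"
      by (simp add: linear_on_def linear_onV[OF \<zeta>] linear_onV[OF \<eta>] pi.add
          pi.vs1.scale_right_distrib)
    moreover have "shift ?\<theta> e = shift \<eta> (shift \<zeta> e)" for e
      by (simp add: shift_def pi.add linear_onV[OF \<zeta>] add.assoc)
    ultimately show "((m, n), (m'', n'')) \<in> C_pi_cohom sE sA sc pr \<pi>"
      using 1 2 unfolding C_pi_cohom_iff by (intro conjI exI[of _ ?\<theta>]) (simp_all add: hom hom')
  qed
qed

text \<open>
  For the same \<open>\<zeta>\<close>, the equations between crossed systems say that the shift by \<open>\<zeta>\<close> is a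
  homomorphism for both operations.
\<close>

lemma GC_cohom_iff:
  assumes C: "C \<in> GC sA sE sc pr V" and C': "C' \<in> GC sA sE sc pr V"
  shows "(C, C') \<in> GC_cohom sA sE sc pr V \<longleftrightarrow>
    (crossed_product_on sc pr V s C, crossed_product_on sc pr V s C') \<in> C_pi_cohom sE sA sc pr \<pi>"
proof -
  have c: "crossed_components (om1 C) (lsc C) (rsc C) (scV C)"
      "crossed_components (om2 C) (lpr C) (rpr C) (prV C)"
    and c': "crossed_components (om1 C') (lsc C') (rsc C') (scV C')"
      "crossed_components (om2 C') (lpr C') (rpr C') (prV C')"
    using C C' by (auto simp: GC_iff)
  have "(C, C') \<in> GC_cohom sA sE sc pr V \<longleftrightarrow> (\<exists>\<zeta>. linear_on sA sE UNIV V \<zeta> \<and>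
      (\<forall>e f. shift \<zeta> (crossed_op_on_E sc (om1 C) (lsc C) (rsc C) (scV C) e f) =
        crossed_op_on_E sc (om1 C') (lsc C') (rsc C') (scV C') (shift \<zeta> e) (shift \<zeta> f)) \<and>
      (\<forall>e f. shift \<zeta> (crossed_op_on_E pr (om2 C) (lpr C) (rpr C) (prV C) e f) =
        crossed_op_on_E pr (om2 C') (lpr C') (rpr C') (prV C') (shift \<zeta> e) (shift \<zeta> f)))"
    unfolding GC_cohom_def mem_Collect_eq case_prod_conv
    by (simp only: C C' simp_thms, rule iff_exI, rule conj_cong[OF refl],
        simp only: shift_multiplicative_iff[OF c(1) c'(1) bilinear_sc]
          shift_multiplicative_iff[OF c(2) c'(2) bilinear_pr]) blast
  then show ?thesis
    using crossed_product_on_in_C_pi[OF C] crossed_product_on_in_C_pi[OF C']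
    unfolding crossed_product_on_eq C_pi_cohom_iff by blast
qed

end

theorem theorem4p6:
  fixes sA :: "'k::field \<Rightarrow> 'a::ab_group_add \<Rightarrow> 'a"
    and sE :: "'k \<Rightarrow> 'e::ab_group_add \<Rightarrow> 'e"
    and sc pr :: "'a \<Rightarrow> 'a \<Rightarrow> 'a"
    and \<pi> :: "'e \<Rightarrow> 'a"
    and s :: "'a \<Rightarrow> 'e"
    and V :: "'e set"
  assumes "anti_dendriform_on sA UNIV sc pr"
    and "vector_space sE"
    and "Vector_Spaces.linear sE sA \<pi>" and "surj \<pi>"
    and "V = {v. \<pi> v = 0}"
    and "Vector_Spaces.linear sA sE s" and "\<pi> \<circ> s = id"
  shows "equiv (GC sA sE sc pr V) (GC_cohom sA sE sc pr V) \<and>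
    equiv (C_pi sE sA sc pr \<pi>) (C_pi_cohom sE sA sc pr \<pi>) \<and>
    (\<exists>\<Theta>. (\<forall>C \<in> GC sA sE sc pr V.
             \<Theta> (GC_cohom sA sE sc pr V `` {C}) =
               C_pi_cohom sE sA sc pr \<pi> `` {crossed_product_on sc pr V s C}) \<and>
         bij_betw \<Theta> (GC sA sE sc pr V // GC_cohom sA sE sc pr V)
                    (C_pi sE sA sc pr \<pi> // C_pi_cohom sE sA sc pr \<pi>))"
proof -
  interpret pi: Vector_Spaces.linear sE sA \<pi> by fact
  interpret sec: Vector_Spaces.linear sA sE s by fact
  interpret split_algebra_epimorphism sE sA \<pi> s sc pr
  proof unfold_locales
    show "\<pi> (s x) = x" for x
      using \<open>\<pi> \<circ> s = id\<close> by (metis comp_apply id_apply)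
    show "bilinear_on sA sA sA UNIV UNIV UNIV sc" "bilinear_on sA sA sA UNIV UNIV UNIV pr"
      using \<open>anti_dendriform_on sA UNIV sc pr\<close> by (auto simp: anti_dendriform_on_def)
  qed
  have "GC_cohom sA sE sc pr {v. \<pi> v = 0} \<subseteq>
      GC sA sE sc pr {v. \<pi> v = 0} \<times> GC sA sE sc pr {v. \<pi> v = 0}"
    by (auto simp: GC_cohom_def)
  note pullback = bij_betw_quotient_pullback[OF bij_betw_crossed_product_on equiv_C_pi_cohom
      this GC_cohom_iff]
  show ?thesis
    unfolding \<open>V = {v. \<pi> v = 0}\<close>
    using pullback equiv_C_pi_cohom
    by (intro conjI exI[of _ "(`) (crossed_product_on sc pr {v. \<pi> v = 0} s)"]) auto
qed

end
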